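(* Let $k$ and $m$ be positive integers with $k$ odd. If a finite graph $G$ is $(2mk:mk)$-choosable, then $G$ is also $2m$-choosable.
   Context: A graph $G=(V,E)$ is $(a:b)$-choosable if for every family of sets $\{S(v):v\in V\}$ with $|S(v)|=a$ for all $v$, there are subsets $C(v)\subseteq S(v)$ with $|C(v)|=b$ for all $v$ and $C(u)\cap C(v)=\emptyset$ for every two adjacent $u,v$. $G$ is $k$-choosable if it is $(k:1)$-choosable. *)

theory Defs
  imports "Graph_Theory.Digraph"
begin

text \<open>
  Graphs are finite simple graphs in the sense of the locale \<open>graph\<close>, which represents an
  undirected edge by a pair of opposite arcs; thus \<open>u \<rightarrow>\<^bsub>G\<^esub> v\<close> says that \<open>u\<close> and \<open>v\<close> are adjacent.

  Colours are natural numbers. For a finite graph this is no restriction, since the lists of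
  colours involve only finitely many colours; see \<open>ab_choosable_any_colours\<close> below.
  Finiteness of the lists is explicit because \<open>card\<close> is \<open>0\<close> on infinite sets.
\<close>

definition ab_choosable :: "('v, 'e) pre_digraph \<Rightarrow> nat \<Rightarrow> nat \<Rightarrow> bool" where
  "ab_choosable G a b \<longleftrightarrow>
     (\<forall>S :: 'v \<Rightarrow> nat set.
        (\<forall>v\<in>verts G. finite (S v) \<and> card (S v) = a) \<longrightarrow>
        (\<exists>C :: 'v \<Rightarrow> nat set.
           (\<forall>v\<in>verts G. C v \<subseteq> S v \<and> card (C v) = b) \<and>
           (\<forall>u\<in>verts G. \<forall>v\<in>verts G. u \<rightarrow>\<^bsub>G\<^esub> v \<longrightarrow> C u \<inter> C v = {})))"

definition choosable :: "('v, 'e) pre_digraph \<Rightarrow> nat \<Rightarrow> bool" where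
  "choosable G k \<longleftrightarrow> ab_choosable G k 1"

lemma ab_choosable_any_colours:
  fixes G :: "('v, 'e) pre_digraph" and S :: "'v \<Rightarrow> 'c set"
  assumes "finite (verts G)" and "ab_choosable G a b"
    and S: "\<And>v. v \<in> verts G \<Longrightarrow> finite (S v) \<and> card (S v) = a"
  shows "\<exists>C :: 'v \<Rightarrow> 'c set.
           (\<forall>v\<in>verts G. C v \<subseteq> S v \<and> card (C v) = b) \<and>
           (\<forall>u\<in>verts G. \<forall>v\<in>verts G. u \<rightarrow>\<^bsub>G\<^esub> v \<longrightarrow> C u \<inter> C v = {})"
proof -
  let ?U = "\<Union>v\<in>verts G. S v"
  have "finite ?U" using assms(1) by (rule finite_UN_I) (rule S[THEN conjunct1])
  then obtain f :: "'c \<Rightarrow> nat" where f: "inj_on f ?U"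
    by (elim finite_imp_inj_to_nat_seg[elim_format] exE conjE) (rule that)
  have sub: "S v \<subseteq> ?U" if "v \<in> verts G" for v using that by (rule UN_upper)
  have "\<forall>v\<in>verts G. finite (f ` S v) \<and> card (f ` S v) = a"
  proof
    fix v assume v: "v \<in> verts G"
    have "card (f ` S v) = card (S v)" by (rule card_image[OF inj_on_subset[OF f sub[OF v]]])
    then show "finite (f ` S v) \<and> card (f ` S v) = a" using S[OF v] by simp
  qed
  with assms(2) have "\<exists>D :: 'v \<Rightarrow> nat set.
      (\<forall>v\<in>verts G. D v \<subseteq> f ` S v \<and> card (D v) = b) \<and>
      (\<forall>u\<in>verts G. \<forall>v\<in>verts G. u \<rightarrow>\<^bsub>G\<^esub> v \<longrightarrow> D u \<inter> D v = {})"
    unfolding ab_choosable_def by (elim allE[where x = "\<lambda>v. f ` S v"] impE)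
  then obtain D where D: "\<forall>v\<in>verts G. D v \<subseteq> f ` S v \<and> card (D v) = b"
    and disj: "\<forall>u\<in>verts G. \<forall>v\<in>verts G. u \<rightarrow>\<^bsub>G\<^esub> v \<longrightarrow> D u \<inter> D v = {}"
    by (elim exE conjE) (rule that)
  define C where "C v = {x \<in> S v. f x \<in> D v}" for v
  have img: "f ` C v = D v" if "v \<in> verts G" for v
  proof -
    have "D v \<subseteq> f ` S v" using D that by simp
    then show ?thesis unfolding C_def by blast
  qed
  have C1: "C v \<subseteq> S v \<and> card (C v) = b" if v: "v \<in> verts G" for v
  proof
    show "C v \<subseteq> S v" unfolding C_def by blast
    then have "inj_on f (C v)" by (intro inj_on_subset[OF f] subset_trans[OF _ sub[OF v]])
    then have "card (f ` C v) = card (C v)" by (rule card_image)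
    moreover have "card (D v) = b" using D v by simp
    ultimately show "card (C v) = b" by (simp add: img[OF v])
  qed
  have C2: "C u \<inter> C v = {}" if "u \<in> verts G" "v \<in> verts G" "u \<rightarrow>\<^bsub>G\<^esub> v" for u v
  proof -
    have "D u \<inter> D v = {}" using disj that by simp
    then show ?thesis unfolding C_def by blast
  qed
  show ?thesis
    by (rule exI[of _ C], intro conjI ballI impI)
      (erule C1[THEN conjunct1], erule C1[THEN conjunct2], rule C2)
qed

end

theory Submission
  imports Defs
begin

text \<open>
  Replace each colour of a family of \<open>2 m\<close>-element lists by \<open>k\<close> copies and choose \<open>m k\<close> of the
  \<open>2 m k\<close> copies at every vertex. On average a vertex receives \<open>k / 2\<close> copies of a colour of its
  list, so, \<open>k\<close> being odd, it receives more than \<open>k / 2\<close> copies of some colour. Adjacent vertices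
  cannot both receive more than half of the \<open>k\<close> copies of the same colour.
\<close>

text \<open>Averaging: \<open>D\<close> is the disjoint union of its fibres over the
  \<open>2 * m\<close> colours of \<open>A\<close>, so fibres all smaller than \<open>k / 2\<close>
  would give fewer than \<open>m * k\<close> elements.\<close>

lemma large_fibre:
  fixes D :: "('c \<times> nat) set"
  assumes "finite A" "card A = 2 * m" "m > 0" "odd k"
    and "D \<subseteq> A \<times> {..<k}" "card D = m * k"
  shows "\<exists>c\<in>A. k < 2 * card (D `` {c})"
proof (rule ccontr)
  assume le: "\<not> ?thesis"
  have small: "2 * card (D `` {c}) < k" if "c \<in> A" for c
  proof -
    \<comment> \<open>Parity excludes a fibre of size exactly half of \<open>k\<close>; this makes
      the bound strict.\<close>
    have "2 * card (D `` {c}) \<noteq> k"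
      using \<open>odd k\<close> by auto
    then show ?thesis
      using le that by fastforce
  qed
  have "finite (D `` {c})" for c
    by (rule finite_subset[of _ "{..<k}"]) (use assms(5) in auto)
  then have "card (SIGMA c:A. D `` {c}) = (\<Sum>c\<in>A. card (D `` {c}))"
    using \<open>finite A\<close> by simp
  moreover have "(SIGMA c:A. D `` {c}) = D"
    using assms(5) by blast
  ultimately have "card D = (\<Sum>c\<in>A. card (D `` {c}))"
    by simp
  then have "2 * (m * k) = (\<Sum>c\<in>A. 2 * card (D `` {c}))"
    using assms(6) by (simp add: sum_distrib_left)
  \<comment> \<open>Strictness survives summation because \<open>m > 0\<close> makes
    \<open>A\<close> nonempty.\<close>
  also have "\<dots> < (\<Sum>c\<in>A. k)"
    using assms(1-3) small by (intro sum_strict_mono) auto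
  finally show False
    using assms(2) by simp
qed

lemma large_subsets_meet:
  assumes "X \<subseteq> {..<k}" "Y \<subseteq> {..<k}" "k < 2 * card X" "k < 2 * card Y"
  shows "X \<inter> Y \<noteq> {}"
proof
  assume "X \<inter> Y = {}"
  moreover have "finite X" "finite Y"
    using assms(1,2) finite_subset by blast+
  ultimately have "card X + card Y = card (X \<union> Y)"
    by (simp add: card_Un_disjoint)
  also have "\<dots> \<le> k"
    using card_mono[of "{..<k}" "X \<union> Y"] assms(1,2) by simp
  finally show False
    using assms(3,4) by simp
qed

theorem theorem5p3:
  fixes G :: "('v, 'e) pre_digraph" and k m :: nat
  assumes "graph G"
    and "k > 0" and "m > 0" and "odd k"
    and "ab_choosable G (2 * m * k) (m * k)"
  shows "choosable G (2 * m)"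
  unfolding choosable_def ab_choosable_def
proof (intro allI impI)
  fix S :: "'v \<Rightarrow> nat set"
  assume S: "\<forall>v\<in>verts G. finite (S v) \<and> card (S v) = 2 * m"
  interpret graph G by fact
  \<comment> \<open>The pair \<open>(c, i)\<close> is the \<open>i\<close>-th copy of colour
    \<open>c\<close>, so the lists are \<open>S v \<times> {..<k}\<close>, of size
    \<open>2 * m * k\<close>.\<close>
  have "\<exists>D :: 'v \<Rightarrow> (nat \<times> nat) set.
      (\<forall>v\<in>verts G. D v \<subseteq> S v \<times> {..<k} \<and> card (D v) = m * k) \<and>
      (\<forall>u\<in>verts G. \<forall>v\<in>verts G. u \<rightarrow>\<^bsub>G\<^esub> v \<longrightarrow> D u \<inter> D v = {})"
    using S by (intro ab_choosable_any_colours[OF _ assms(5)]) (auto simp: card_cartesian_product)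
  then obtain D :: "'v \<Rightarrow> (nat \<times> nat) set"
    where D: "\<forall>v\<in>verts G. D v \<subseteq> S v \<times> {..<k} \<and> card (D v) = m * k"
      and disj: "\<forall>u\<in>verts G. \<forall>v\<in>verts G. u \<rightarrow>\<^bsub>G\<^esub> v \<longrightarrow> D u \<inter> D v = {}"
    by (elim exE conjE)
  have "\<exists>c\<in>S v. k < 2 * card (D v `` {c})" if "v \<in> verts G" for v
    using S D that assms(3,4) by (intro large_fibre) auto
  then obtain f where f: "\<And>v. v \<in> verts G \<Longrightarrow> f v \<in> S v \<and> k < 2 * card (D v `` {f v})"
    by metis
  have "f u \<noteq> f v" if uv: "u \<in> verts G" "v \<in> verts G" "u \<rightarrow>\<^bsub>G\<^esub> v" for u v
  proof
    assume eq: "f u = f v"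
    have "D w `` {c} \<subseteq> {..<k}" if "w \<in> verts G" for w c
      using D that by blast
    then have "D u `` {f u} \<inter> D v `` {f v} \<noteq> {}"
      using f uv by (intro large_subsets_meet[of _ k]) simp_all
    \<comment> \<open>As \<open>f u = f v\<close>, a common index \<open>i\<close> of the two fibres
      puts the same pair \<open>(f u, i)\<close> into both \<open>D u\<close> and
      \<open>D v\<close>.\<close>
    then show False
      using disj uv eq by fastforce
  qed
  then show "\<exists>C. (\<forall>v\<in>verts G. C v \<subseteq> S v \<and> card (C v) = 1) \<and>
      (\<forall>u\<in>verts G. \<forall>v\<in>verts G. u \<rightarrow>\<^bsub>G\<^esub> v \<longrightarrow> C u \<inter> C v = {})"
    using f by (intro exI[of _ "\<lambda>v. {f v}"]) auto
qed

end
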